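(* Let $\mathscr{H}$ be a complex Hilbert space and, for each $n\in\mathbb{N}$, let $P_n\in\mathbb{B}(\mathscr{H})$ be the orthogonal projection onto a closed subspace $\mathscr{M}_n$ of $\mathscr{H}$. Let $\sigma:\mathbb{N}\to\mathbb{N}$ be an infinite-periodic function such that $\Gamma_\infty=\{1,\ldots,r\}$ for some $r\in\mathbb{N}$. Set $T_1:=P_{\sigma(1)}$ and $T_n:=P_{\sigma(n)}T_{n-1}$ for all $n\ge 2$. Then, for every $x\in\mathscr{H}$, the sequence $\{T_nx\}_{n=1}^\infty$ converges weakly to $Px$, where $P$ is the orthogonal projection onto $\bigcap_{i\in\mathbb{N}}\mathcal{R}(P_i)$.
   Context: Here $\mathbb{N}=\{1,2,3,\ldots\}$, $\mathbb{B}(\mathscr{H})$ is the algebra of bounded linear operators on $\mathscr{H}$, and $\mathcal{R}(T)$ is the range of $T$. Let $\sigma:\mathbb{N}\to\mathbb{N}$ be a surjective function such that $\sigma^{-1}(j)$ is infinite for every $j\in\mathbb{N}$. For each $j$, let $l_1<l_2<\cdots$ be the strictly increasing enumeration of $\sigma^{-1}(j)$, put $l_0=0$, and let $I(\sigma,j)=\sup_{n\ge1}(l_n-l_{n-1})\in[1,\infty]$. Let $\Gamma_F=\{j\in\mathbb{N}: I(\sigma,j)<\infty\}$ and $\Gamma_\infty=\mathbb{N}\setminus\Gamma_F$. Such a $\sigma$ is called infinite-periodic if $\Gamma_\infty$ is a finite set (possibly empty). *)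

theory Defs
  imports "HOL-Analysis.Analysis" "HOL-Library.Infinite_Set" "HOL-Library.Extended_Nat"
begin

class complex_vector = real_vector +
  fixes scaleC :: "complex \<Rightarrow> 'a \<Rightarrow> 'a"  (infixr \<open>*\<^sub>C\<close> 75)
  assumes scaleC_add_right: "a *\<^sub>C (x + y) = a *\<^sub>C x + a *\<^sub>C y"
    and scaleC_add_left: "(a + b) *\<^sub>C x = a *\<^sub>C x + b *\<^sub>C x"
    and scaleC_scaleC: "a *\<^sub>C (b *\<^sub>C x) = (a * b) *\<^sub>C x"
    and scaleC_one: "1 *\<^sub>C x = x"
    and scaleR_scaleC: "r *\<^sub>R x = complex_of_real r *\<^sub>C x"

(* The inner product is linear in its first argument.  Positive definiteness of cinner and
   norm x = sqrt (Re (cinner x x)) are inherited from real_inner through inner_eq_Re_cinner,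
   as cinner x x is real by cinner_commute. *)
class complex_inner = complex_vector + real_inner +
  fixes cinner :: "'a \<Rightarrow> 'a \<Rightarrow> complex"
  assumes cinner_commute: "cinner x y = cnj (cinner y x)"
    and cinner_add_left: "cinner (x + y) z = cinner x z + cinner y z"
    and cinner_scaleC_left: "cinner (a *\<^sub>C x) y = a * cinner x y"
    and inner_eq_Re_cinner: "inner x y = Re (cinner x y)"

class complex_hilbert_space = complex_inner + complete_space

instantiation complex :: complex_hilbert_space
begin

definition scaleC_complex :: "complex \<Rightarrow> complex \<Rightarrow> complex"
  where "scaleC_complex a x = a * x"

definition cinner_complex :: "complex \<Rightarrow> complex \<Rightarrow> complex"
  where "cinner_complex x y = x * cnj y"

instance
  by standard (auto simp: scaleC_complex_def cinner_complex_def algebra_simps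
      scaleR_conv_of_real inner_complex_def)

end

definition csubspace :: "'a::complex_vector set \<Rightarrow> bool" where
  "csubspace M \<longleftrightarrow>
     0 \<in> M \<and> (\<forall>x\<in>M. \<forall>y\<in>M. x + y \<in> M) \<and> (\<forall>a. \<forall>x\<in>M. a *\<^sub>C x \<in> M)"

definition bounded_clinear ::
    "('a::complex_inner \<Rightarrow> 'b::complex_inner) \<Rightarrow> bool" where
  "bounded_clinear f \<longleftrightarrow>
     (\<forall>x y. f (x + y) = f x + f y) \<and> (\<forall>a x. f (a *\<^sub>C x) = a *\<^sub>C f x) \<and>
     (\<exists>K. \<forall>x. norm (f x) \<le> K * norm x)"

definition orthogonal_projection_onto ::
    "('a::complex_inner \<Rightarrow> 'a) \<Rightarrow> 'a set \<Rightarrow> bool" where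
  "orthogonal_projection_onto P M \<longleftrightarrow>
     bounded_clinear P \<and> (\<forall>x. P x \<in> M \<and> (\<forall>y\<in>M. cinner (x - P x) y = 0))"

definition converges_weakly :: "(nat \<Rightarrow> 'a::complex_inner) \<Rightarrow> 'a \<Rightarrow> bool" where
  "converges_weakly X x \<longleftrightarrow> (\<forall>y. (\<lambda>n. cinner (X n) y) \<longlonglongrightarrow> cinner x y)"

(* Throughout, the positive integers are {1..} :: nat set; a function between positive integers
   is a function on nat whose value at 0 is irrelevant. *)

definition occurrences :: "(nat \<Rightarrow> nat) \<Rightarrow> nat \<Rightarrow> nat set" where
  "occurrences \<sigma> j = {n \<in> {1..}. \<sigma> n = j}"

(* l_0 = 0 and l_1 < l_2 < ... enumerates the occurrences of j; enumerate counts from 0. *)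
definition occurrence :: "(nat \<Rightarrow> nat) \<Rightarrow> nat \<Rightarrow> nat \<Rightarrow> nat" where
  "occurrence \<sigma> j n = (if n = 0 then 0 else enumerate (occurrences \<sigma> j) (n - 1))"

definition max_gap :: "(nat \<Rightarrow> nat) \<Rightarrow> nat \<Rightarrow> enat" where
  "max_gap \<sigma> j = (SUP n\<in>{1..}. enat (occurrence \<sigma> j n - occurrence \<sigma> j (n - 1)))"

definition Gamma_fin :: "(nat \<Rightarrow> nat) \<Rightarrow> nat set" where
  "Gamma_fin \<sigma> = {j \<in> {1..}. max_gap \<sigma> j < \<infinity>}"

definition Gamma_inf :: "(nat \<Rightarrow> nat) \<Rightarrow> nat set" where
  "Gamma_inf \<sigma> = {1..} - Gamma_fin \<sigma>"

definition infinite_periodic :: "(nat \<Rightarrow> nat) \<Rightarrow> bool" where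
  "infinite_periodic \<sigma> \<longleftrightarrow>
     \<sigma> ` {1..} = {1..} \<and> (\<forall>j\<ge>1. infinite (occurrences \<sigma> j)) \<and> finite (Gamma_inf \<sigma>)"

end

theory Submission
  imports Defs
begin

text \<open>Along the orbit the successive differences tend to \<open>0\<close> in norm, so an index with bounded gaps
  makes the orbit asymptotically orthogonal to every vector orthogonal to its subspace. For the finitely
  many other indices, induction on the set \<open>J\<close> of those occurring between times \<open>m \<le> n\<close> gives that
  \<open>X m - X n\<close> tends weakly to \<open>0\<close>. Taking \<open>J\<close> to be all of them, and \<open>n\<close> the next occurrence of a
  given index, the orbit is asymptotically orthogonal to the complement of every subspace, while its
  inner products with vectors common to all subspaces never change. Testing against individual vectors
  in this way avoids weak compactness.\<close>

section \<open>Orthogonal complements in real Hilbert spaces\<close>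

text \<open>A sequence in \<open>G\<close> minimizing the distance to \<open>y\<close> is Cauchy by
  the parallelogram law, and its limit \<open>l\<close> is a closest point.\<close>

lemma subspace_orthogonal_decomposition:
  fixes G :: "'a::{real_inner,complete_space} set"
  assumes "subspace G" "closed G"
  obtains l where "l \<in> G" "\<And>g. g \<in> G \<Longrightarrow> inner (y - l) g = 0"
proof -
  let ?D = "(\<lambda>g. (norm (y - g))\<^sup>2) ` G"
  define a where "a = Inf ?D"
  have bdd: "bdd_below ?D" by (rule bdd_belowI[of _ 0]) auto
  have ne: "?D \<noteq> {}" using subspace_0[OF assms(1)] by auto
  have a_le: "a \<le> (norm (y - g))\<^sup>2" if "g \<in> G" for g
    unfolding a_def using that bdd by (intro cInf_lower) auto
  have "\<exists>g\<in>G. (norm (y - g))\<^sup>2 < a + 1 / real (Suc n)" for n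
    using cInf_lessD[OF ne, of "a + 1 / real (Suc n)"] unfolding a_def by auto
  then obtain h where h: "\<And>n. h n \<in> G" "\<And>n. (norm (y - h n))\<^sup>2 < a + 1 / real (Suc n)"
    by metis
  have h_dist: "(norm (h m - h n))\<^sup>2 \<le> 2 / real (Suc m) + 2 / real (Suc n)" for m n
  proof -
    have "(1/2) *\<^sub>R (h m + h n) \<in> G"
      using h(1) assms(1) by (intro subspace_scale subspace_add)
    then have "a \<le> (norm (y - (1/2) *\<^sub>R (h m + h n)))\<^sup>2" by (rule a_le)
    \<comment> \<open>Parallelogram law for \<open>y - h m\<close> and \<open>y - h n\<close>. The
      midpoint lies in \<open>G\<close>, so the subtracted term is at least
      \<open>4 * a\<close>.\<close>
    moreover have "(norm (h m - h n))\<^sup>2 = 2 * (norm (y - h m))\<^sup>2 + 2 * (norm (y - h n))\<^sup>2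
        - 4 * (norm (y - (1/2) *\<^sub>R (h m + h n)))\<^sup>2"
      by (simp add: power2_norm_eq_inner algebra_simps inner_commute)
    ultimately show ?thesis using h(2)[of m] h(2)[of n] by simp
  qed
  have "Cauchy h"
  proof (rule CauchyI)
    fix e :: real assume "0 < e"
    then obtain N where N: "inverse (real (Suc N)) < e\<^sup>2 / 4"
      using reals_Archimedean[of "e\<^sup>2 / 4"] by auto
    have "norm (h m - h n) < e" if "m \<ge> N" "n \<ge> N" for m n
    proof -
      have "inverse (real (Suc k)) \<le> inverse (real (Suc N))" if "k \<ge> N" for k
        using that by (intro le_imp_inverse_le) auto
      then have "inverse (real (Suc m)) < e\<^sup>2 / 4" "inverse (real (Suc n)) < e\<^sup>2 / 4"
        using that N by (meson le_less_trans)+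
      then have "(norm (h m - h n))\<^sup>2 < e\<^sup>2"
        using h_dist[of m n] unfolding divide_inverse[of 2] by linarith
      then show ?thesis by (rule power2_less_imp_less) (use \<open>0 < e\<close> in simp)
    qed
    then show "\<exists>N. \<forall>m\<ge>N. \<forall>n\<ge>N. norm (h m - h n) < e" by blast
  qed
  then obtain l where l: "h \<longlonglongrightarrow> l"
    using Cauchy_convergent convergent_def by blast
  have "l \<in> G" using assms(2) h(1) l by (rule closed_sequentially)
  have "(\<lambda>n. (norm (y - h n))\<^sup>2) \<longlonglongrightarrow> (norm (y - l))\<^sup>2"
    by (intro tendsto_intros l)
  moreover have "(\<lambda>n. a + 1 / real (Suc n)) \<longlonglongrightarrow> a + 0"
    by (intro tendsto_intros LIMSEQ_Suc lim_1_over_n)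
  ultimately have "(norm (y - l))\<^sup>2 \<le> a + 0"
    by (rule LIMSEQ_le) (use h(2) less_imp_le in blast)
  then have "dist y l \<le> dist y z" if "z \<in> G" for z
    using a_le[OF that] unfolding dist_norm by (simp add: norm_le power2_norm_eq_inner)
  then have le: "inner (y - l) (z - l) \<le> 0" if "z \<in> G" for z
    using any_closest_point_dot[of G l z y] subspace_imp_convex[OF assms(1)] assms(2)
      \<open>l \<in> G\<close> that by blast
  \<comment> \<open>The obtuse-angle inequality at \<open>l + g\<close> and \<open>l - g\<close>
    gives both signs.\<close>
  have "inner (y - l) g = 0" if "g \<in> G" for g
    using le[of "l + g"] le[of "l - g"] \<open>l \<in> G\<close> that assms(1)
    by (simp add: subspace_add subspace_diff)
  with \<open>l \<in> G\<close> show ?thesis by (rule that)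
qed

text \<open>The double complement of a closed subspace: the residual \<open>y - l\<close> lies in
  the complement, so it may be tested against itself.\<close>

lemma mem_subspace_if_orthogonal_to_complement:
  fixes G :: "'a::{real_inner,complete_space} set"
  assumes "subspace G" "closed G"
    and "\<And>z. (\<And>g. g \<in> G \<Longrightarrow> inner z g = 0) \<Longrightarrow> inner y z = 0"
  shows "y \<in> G"
proof -
  obtain l where l: "l \<in> G" "\<And>g. g \<in> G \<Longrightarrow> inner (y - l) g = 0"
    using subspace_orthogonal_decomposition[OF assms(1,2)] by metis
  have "inner (y - l) (y - l) = 0"
    using assms(3)[of "y - l"] l by (simp add: inner_diff inner_commute)
  then show ?thesis using l(1) by simp
qed

section \<open>Test vectors on which a bounded family is weakly null\<close>

lemma subspace_weakly_null: "subspace {y. ((\<lambda>k. inner (v k) y) \<longlongrightarrow> 0) F}"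
  unfolding subspace_def
  by (auto simp: inner_add_right intro: tendsto_add_zero tendsto_mult_right_zero)

text \<open>By Cauchy-Schwarz and the bound \<open>B\<close>, replacing \<open>y\<close> by a nearby
  \<open>h n\<close> costs an error that is small uniformly in \<open>k\<close>.\<close>

lemma closed_weakly_null:
  fixes v :: "'b \<Rightarrow> 'a::real_inner"
  assumes "\<And>k. norm (v k) \<le> B"
  shows "closed {y. ((\<lambda>k. inner (v k) y) \<longlongrightarrow> 0) F}"
proof -
  have "((\<lambda>k. inner (v k) y) \<longlongrightarrow> 0) F"
    if h: "\<And>n. ((\<lambda>k. inner (v k) (h n)) \<longlongrightarrow> 0) F" "h \<longlonglongrightarrow> y" for h :: "nat \<Rightarrow> 'a" and y
  proof (rule tendstoI)
    fix e :: real assume "0 < e"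
    have "(\<lambda>n. B * norm (y - h n)) \<longlonglongrightarrow> B * norm (y - y)"
      by (intro tendsto_intros h)
    then have "\<forall>\<^sub>F n in sequentially. B * norm (y - h n) < e / 2"
      using \<open>0 < e\<close> by (intro order_tendstoD) auto
    then obtain n where n: "B * norm (y - h n) < e / 2"
      by (auto simp: eventually_sequentially)
    have tail: "\<bar>inner (v k) (y - h n)\<bar> < e / 2" for k
      using Cauchy_Schwarz_ineq2[of "v k" "y - h n"] mult_right_mono[OF assms[of k], of "norm (y - h n)"] n
      by simp
    have "\<forall>\<^sub>F k in F. dist (inner (v k) (h n)) 0 < e / 2"
      using h(1)[of n] \<open>0 < e\<close> by (intro tendstoD) auto
    then show "\<forall>\<^sub>F k in F. dist (inner (v k) y) 0 < e"
    proof eventually_elim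
      case (elim k)
      then show ?case using tail[of k] unfolding inner_diff_right dist_real_def by linarith
    qed
  qed
  then show ?thesis by (auto simp: closed_sequential_limits)
qed

text \<open>The functionals on which \<open>v\<close> is null form a closed subspace; a vector orthogonal to it is
  orthogonal to every complement of an \<open>M i\<close>, hence lies in all \<open>M i\<close>, hence is orthogonal to itself.\<close>

lemma weakly_null_if_null_on_complements:
  fixes v :: "'b \<Rightarrow> 'a::{real_inner,complete_space}"
  assumes bounded: "\<And>k. norm (v k) \<le> B"
    and M: "\<And>i. i \<in> I \<Longrightarrow> subspace (M i)" "\<And>i. i \<in> I \<Longrightarrow> closed (M i)"
    and complement: "\<And>i y. \<lbrakk>i \<in> I; \<And>u. u \<in> M i \<Longrightarrow> inner u y = 0\<rbrakk>
      \<Longrightarrow> ((\<lambda>k. inner (v k) y) \<longlongrightarrow> 0) F"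
    and common: "\<And>y. (\<And>i. i \<in> I \<Longrightarrow> y \<in> M i) \<Longrightarrow> ((\<lambda>k. inner (v k) y) \<longlongrightarrow> 0) F"
  shows "((\<lambda>k. inner (v k) y) \<longlongrightarrow> 0) F"
proof -
  let ?G = "{y. ((\<lambda>k. inner (v k) y) \<longlongrightarrow> 0) F}"
  have "y \<in> ?G"
  proof (rule mem_subspace_if_orthogonal_to_complement[OF subspace_weakly_null closed_weakly_null])
    fix z assume z: "\<And>g. g \<in> ?G \<Longrightarrow> inner z g = 0"
    have "z \<in> M i" if "i \<in> I" for i
    proof (rule mem_subspace_if_orthogonal_to_complement)
      fix w assume "\<And>g. g \<in> M i \<Longrightarrow> inner w g = 0"
      then have "w \<in> ?G" using complement[OF that] by (simp add: inner_commute)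
      then show "inner z w = 0" by (rule z)
    qed (use M that in auto)
    then have "z \<in> ?G" using common by simp
    then have "inner z z = 0" by (rule z)
    then show "inner y z = 0" by simp
  qed (rule bounded)
  then show ?thesis by simp
qed

section \<open>Orbits of successive projections\<close>

text \<open>The two conditions on \<open>X\<close> say that \<open>X (Suc n)\<close> is the
  orthogonal projection of \<open>X n\<close> onto \<open>M (s n)\<close>, so only the orbit and the
  real inner product are mentioned.\<close>

locale projection_orbit =
  fixes M :: "'i \<Rightarrow> 'a::{real_inner,complete_space} set" and s :: "nat \<Rightarrow> 'i" and X :: "nat \<Rightarrow> 'a"
  assumes subspace: "i \<in> range s \<Longrightarrow> subspace (M i)"
    and closed: "i \<in> range s \<Longrightarrow> closed (M i)"
    and X_mem: "X (Suc n) \<in> M (s n)"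
    and X_orth: "u \<in> M (s n) \<Longrightarrow> inner (X n - X (Suc n)) u = 0"
begin

lemma pythagoras: "(norm (X n))\<^sup>2 - (norm (X (Suc n)))\<^sup>2 = (norm (X n - X (Suc n)))\<^sup>2"
  using X_orth[OF X_mem, of n] by (simp add: power2_norm_eq_inner inner_diff inner_commute)

lemma norm_X_decseq: "decseq (\<lambda>n. (norm (X n))\<^sup>2)"
proof (rule decseq_SucI)
  show "(norm (X (Suc n)))\<^sup>2 \<le> (norm (X n))\<^sup>2" for n
    using pythagoras[of n] zero_le_power2[of "norm (X n - X (Suc n))"] by linarith
qed

lemma norm_X_le: "norm (X n) \<le> norm (X 0)"
  by (rule power2_le_imp_le[OF decseqD[OF norm_X_decseq]]) auto

text \<open>The squared norms decrease and are nonnegative, hence converge; by Pythagoras their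
  consecutive gaps are the squared step lengths.\<close>

lemma diff_tendsto_0: "(\<lambda>n. X n - X (Suc n)) \<longlonglongrightarrow> 0"
proof -
  obtain L where L: "(\<lambda>n. (norm (X n))\<^sup>2) \<longlonglongrightarrow> L"
    using decseq_convergent[OF norm_X_decseq, of 0] by auto
  have "(\<lambda>n. sqrt ((norm (X n))\<^sup>2 - (norm (X (Suc n)))\<^sup>2)) \<longlonglongrightarrow> sqrt (L - L)"
    by (rule tendsto_real_sqrt[OF tendsto_diff[OF L LIMSEQ_Suc[OF L]]])
  then have "(\<lambda>n. norm (X n - X (Suc n))) \<longlonglongrightarrow> 0" by (simp add: pythagoras)
  then show ?thesis by (rule tendsto_norm_zero_cancel)
qed

lemma inner_diff_common:
  assumes "m \<le> n" "\<And>i. i \<in> s ` {m..<n} \<Longrightarrow> u \<in> M i"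
  shows "inner (X m - X n) u = 0"
  using assms
proof (induction n rule: dec_induct)
  case (step n)
  have "inner (X m - X n) u = 0" by (rule step.IH) (use step.prems in auto)
  moreover have "inner (X n - X (Suc n)) u = 0" using step by (intro X_orth) auto
  ultimately show ?case by (simp add: inner_diff_left)
qed simp

definition bounded_gaps :: "'i \<Rightarrow> bool" where
  "bounded_gaps i \<longleftrightarrow> (\<exists>K. \<forall>m. \<exists>p\<in>{m..m+K}. s p = i)"

text \<open>Within \<open>K + 1\<close> steps of any time \<open>m\<close> the orbit enters
  \<open>M i\<close>, where it is orthogonal to \<open>y\<close>; a fixed number of steps has total
  length tending to \<open>0\<close>.\<close>

lemma bounded_gaps_tendsto:
  assumes "bounded_gaps i" and y: "\<And>u. u \<in> M i \<Longrightarrow> inner u y = 0"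
  shows "(\<lambda>m. inner (X m) y) \<longlonglongrightarrow> 0"
proof -
  obtain K where K: "\<And>m. \<exists>p\<in>{m..m+K}. s p = i"
    using assms(1) unfolding bounded_gaps_def by auto
  have bound: "norm (inner (X m) y) \<le> (\<Sum>k\<le>K. norm (X (m + k) - X (Suc (m + k)))) * norm y" for m
  proof -
    obtain p where "p \<in> {m..m+K}" "s p = i" using K by blast
    then obtain k where k: "k \<le> K" "s (m + k) = i"
      by (intro that[of "p - m"]) auto
    have telescope: "X m - X (Suc (m + k)) = (\<Sum>j\<le>k. X (m + j) - X (Suc (m + j)))"
      using sum_telescope[of "\<lambda>j. X (m + j)" k] by simp
    have "norm (X m - X (Suc (m + k))) \<le> (\<Sum>j\<le>k. norm (X (m + j) - X (Suc (m + j))))"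
      unfolding telescope by (rule norm_sum)
    also have "\<dots> \<le> (\<Sum>j\<le>K. norm (X (m + j) - X (Suc (m + j))))"
      using k by (intro sum_mono2) auto
    finally have *: "norm (X m - X (Suc (m + k))) \<le> \<dots>" .
    have "inner (X m) y = inner (X m - X (Suc (m + k))) y"
      using y[of "X (Suc (m + k))"] X_mem[of "m + k"] k by (simp add: inner_diff_left)
    also have "\<bar>\<dots>\<bar> \<le> norm (X m - X (Suc (m + k))) * norm y"
      by (rule Cauchy_Schwarz_ineq2)
    finally show ?thesis using mult_right_mono[OF *, of "norm y"] by simp
  qed
  have "(\<lambda>m. (\<Sum>k\<le>K. norm (X (m + k) - X (Suc (m + k)))) * norm y) \<longlonglongrightarrow> 0"
  proof (intro tendsto_mult_left_zero tendsto_null_sum tendsto_norm_zero)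
    show "(\<lambda>m. X (m + k) - X (Suc (m + k))) \<longlonglongrightarrow> 0" for k
      using LIMSEQ_ignore_initial_segment[OF diff_tendsto_0, of k] .
  qed
  then show ?thesis
    by (rule Lim_null_comparison[rotated]) (simp only: bound eventually_True)
qed

text \<open>Only the start \<open>m\<close> is sent to infinity, so convergence along this filter is
  uniform in the end \<open>n\<close>. The projections leading from \<open>X m\<close> to
  \<open>X n\<close> are those at times \<open>{m..<n}\<close>.\<close>

definition segments :: "'i set \<Rightarrow> (nat \<times> nat) filter" where
  "segments J = inf (filtercomap fst sequentially)
     (principal {(m, n). m \<le> n \<and> (\<forall>i\<in>s ` {m..<n}. bounded_gaps i \<or> i \<in> J)})"

lemma eventually_segments:
  "eventually P (segments J) \<longleftrightarrow>
    (\<exists>N. \<forall>m\<ge>N. \<forall>n\<ge>m. (\<forall>i\<in>s ` {m..<n}. bounded_gaps i \<or> i \<in> J) \<longrightarrow> P (m, n))"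
  unfolding segments_def eventually_inf_principal eventually_filtercomap_at_top_linorder
    split_paired_All mem_Collect_eq prod.case fst_conv
  by (rule ex_cong1) blast

text \<open>The argument of Amemiya and Ando. A segment using \<open>i\<close> splits at the first and the last
  occurrence of \<open>i\<close>; the outer pieces avoid \<open>i\<close>, so they are covered by the induction hypothesis, and
  the vectors at the two cuts are orthogonal to \<open>y\<close> in the complement of \<open>M i\<close>.\<close>

lemma segments_weakly_null:
  assumes "finite J" "J \<subseteq> range s"
  shows "((\<lambda>(m, n). inner (X m - X n) y) \<longlongrightarrow> 0) (segments J)"
  using assms
proof (induction J arbitrary: y rule: finite_psubset_induct)
  case (psubset J)
  let ?v = "\<lambda>(m, n). X m - X n"
  have v: "(\<lambda>(m, n). inner (X m - X n) y) = (\<lambda>k. inner (?v k) y)" for y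
    by auto
  show ?case unfolding v
  \<comment> \<open>These are the indices that a segment may use, so a vector common to their
    subspaces has the same inner product with both ends.\<close>
  proof (rule weakly_null_if_null_on_complements[where I = "J \<union> {i \<in> range s. bounded_gaps i}"])
    show "norm (?v k) \<le> norm (X 0) + norm (X 0)" for k
      using norm_triangle_ineq4[of "X (fst k)" "X (snd k)"] norm_X_le[of "fst k"] norm_X_le[of "snd k"]
      by (auto simp: case_prod_beta)
  next
    fix y assume y: "\<And>i. i \<in> J \<union> {i \<in> range s. bounded_gaps i} \<Longrightarrow> y \<in> M i"
    have "inner (X m - X n) y = 0"
      if "m \<le> n" "\<forall>i\<in>s ` {m..<n}. bounded_gaps i \<or> i \<in> J" for m n
      using that(1) by (rule inner_diff_common) (use that(2) y in blast)
    then have "\<forall>\<^sub>F k in segments J. inner (?v k) y = 0"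
      unfolding eventually_segments by simp
    then show "((\<lambda>k. inner (?v k) y) \<longlongrightarrow> 0) (segments J)" by (rule tendsto_eventually)
  next
    fix i y
    assume i: "i \<in> J \<union> {i \<in> range s. bounded_gaps i}" and y: "\<And>u. u \<in> M i \<Longrightarrow> inner u y = 0"
    show "((\<lambda>k. inner (?v k) y) \<longlongrightarrow> 0) (segments J)"
    proof (rule tendstoI)
      fix e :: real assume e: "0 < e"
      have "\<exists>N. \<forall>m\<ge>N. \<forall>n\<ge>m. (\<forall>i\<in>s ` {m..<n}. bounded_gaps i \<or> i \<in> J)
        \<longrightarrow> \<bar>inner (X m - X n) y\<bar> < e"
      proof (cases "bounded_gaps i")
        case True
        from tendstoD[OF bounded_gaps_tendsto[OF this y], of "e / 2"] e
        obtain N where N: "\<And>m. m \<ge> N \<Longrightarrow> \<bar>inner (X m) y\<bar> < e / 2"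
          by (auto simp: eventually_sequentially)
        have "\<bar>inner (X m - X n) y\<bar> < e" if "m \<ge> N" "n \<ge> m" for m n
          using N[of m] N[of n] that by (simp add: inner_diff_left)
        then show ?thesis by blast
      next
        case False
        then have "i \<in> J" using i by auto
        then have "((\<lambda>(m, n). inner (X m - X n) y) \<longlongrightarrow> 0) (segments (J - {i}))"
          using psubset.IH[of "J - {i}" y] psubset.prems by blast
        from tendstoD[OF this, of "e / 4"] e
        obtain N1 where N1: "\<And>m n. \<lbrakk>m \<ge> N1; n \<ge> m; \<forall>j\<in>s ` {m..<n}. bounded_gaps j \<or> j \<in> J - {i}\<rbrakk>
            \<Longrightarrow> \<bar>inner (X m - X n) y\<bar> < e / 4"
          by (auto simp: eventually_segments)
        have "(\<lambda>n. inner (X n - X (Suc n)) y) \<longlonglongrightarrow> inner 0 y"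
          by (intro tendsto_intros diff_tendsto_0)
        from tendstoD[OF this, of "e / 4"] e
        obtain N2 where N2: "\<And>n. n \<ge> N2 \<Longrightarrow> \<bar>inner (X n - X (Suc n)) y\<bar> < e / 4"
          by (auto simp: eventually_sequentially)
        have "\<bar>inner (X m - X n) y\<bar> < e"
          if mn: "m \<ge> max N1 N2" "n \<ge> m" "\<forall>j\<in>s ` {m..<n}. bounded_gaps j \<or> j \<in> J" for m n
        proof (cases "i \<in> s ` {m..<n}")
          case False
          then have "\<bar>inner (X m - X n) y\<bar> < e / 4" using mn by (intro N1) auto
          then show ?thesis using e by simp
        next
          case True
          define A where "A = {p \<in> {m..<n}. s p = i}"
          have A: "finite A" "A \<noteq> {}" unfolding A_def using True by auto
          define p q where "p = Min A" and "q = Max A"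
          have p: "m \<le> p" "p < n" "s p = i" and q: "m \<le> q" "q < n" "s q = i"
            using Min_in[OF A] Max_in[OF A] unfolding p_def q_def A_def by auto
          have before: "s j \<noteq> i" if "m \<le> j" "j < p" for j
            using Min_le[OF A(1), of j] that p unfolding p_def[symmetric] by (auto simp: A_def)
          have after: "s j \<noteq> i" if "q < j" "j < n" for j
            using Max_ge[OF A(1), of j] that q unfolding q_def[symmetric] by (auto simp: A_def)
          have "\<bar>inner (X m - X p) y\<bar> < e / 4"
            using mn p before by (intro N1) auto
          moreover have "\<bar>inner (X p - X (Suc p)) y\<bar> < e / 4"
            using mn p by (intro N2) auto
          moreover have "\<bar>inner (X (Suc q) - X n) y\<bar> < e / 4"
            using mn q after by (intro N1) auto
          \<comment> \<open>Hence the stretch from \<open>Suc p\<close> to \<open>Suc q\<close>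
            contributes nothing, however long it is; the three remaining pieces total less than
            \<open>3 * e / 4\<close>.\<close>
          moreover have "inner (X (Suc p)) y = 0" "inner (X (Suc q)) y = 0"
            using y X_mem[of p] X_mem[of q] p q by auto
          ultimately show ?thesis unfolding inner_diff_left by linarith
        qed
        then show ?thesis by blast
      qed
      then show "\<forall>\<^sub>F k in segments J. dist (inner (?v k) y) 0 < e"
        by (simp add: eventually_segments)
    qed
  next
    show "subspace (M i)" "closed (M i)" if "i \<in> J \<union> {i \<in> range s. bounded_gaps i}" for i
      using that psubset.prems by (blast intro: subspace closed)+
  qed
qed

theorem weakly_tendsto:
  assumes finite: "finite {i \<in> range s. \<not> bounded_gaps i}"
    and recurrent: "\<And>i m. i \<in> range s \<Longrightarrow> \<exists>p\<ge>m. s p = i"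
    and z: "z \<in> (\<Inter>i\<in>range s. M i)" "\<And>u. u \<in> (\<Inter>i\<in>range s. M i) \<Longrightarrow> inner (X 0 - z) u = 0"
  shows "(\<lambda>n. inner (X n) y) \<longlonglongrightarrow> inner z y"
proof -
  have "(\<lambda>n. inner (X n - z) y) \<longlonglongrightarrow> 0"
  proof (rule weakly_null_if_null_on_complements[where I = "range s"])
    show "norm (X n - z) \<le> norm (X 0) + norm z" for n
      using norm_triangle_ineq4[of "X n" z] norm_X_le[of n] by simp
  next
    fix y assume y: "\<And>i. i \<in> range s \<Longrightarrow> y \<in> M i"
    \<comment> \<open>Both \<open>X n\<close> and \<open>z\<close> differ from \<open>X 0\<close> by
      a vector orthogonal to \<open>y\<close>.\<close>
    have "inner (X n - z) y = 0" for n
    proof -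
      have "inner (X 0 - X n) y = 0" by (rule inner_diff_common) (use y in auto)
      moreover have "inner (X 0 - z) y = 0" using y by (intro z(2)) blast
      ultimately show ?thesis by (simp add: inner_diff_left)
    qed
    then show "(\<lambda>n. inner (X n - z) y) \<longlonglongrightarrow> 0" by simp
  next
    fix i y assume i: "i \<in> range s" and y: "\<And>u. u \<in> M i \<Longrightarrow> inner u y = 0"
    have "(\<lambda>n. inner (X n) y) \<longlonglongrightarrow> 0"
    proof (rule tendstoI)
      fix e :: real assume e: "0 < e"
      \<comment> \<open>With \<open>J\<close> the set of all indices without bounded gaps, every
        pair \<open>m \<le> n\<close> is an admissible segment.\<close>
      from tendstoD[OF segments_weakly_null[OF finite, of y], of e] e
      obtain N where N: "\<And>m n. \<lbrakk>m \<ge> N; n \<ge> m\<rbrakk> \<Longrightarrow> \<bar>inner (X m - X n) y\<bar> < e"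
        by (auto simp: eventually_segments)
      have "\<bar>inner (X m) y\<bar> < e" if "m \<ge> N" for m
      proof -
        obtain p where p: "p \<ge> m" "s p = i" using recurrent[OF i] by auto
        then have "inner (X (Suc p)) y = 0" using y X_mem[of p] by auto
        then show ?thesis using N[of m "Suc p"] that p by (simp add: inner_diff_left)
      qed
      then show "\<forall>\<^sub>F n in sequentially. dist (inner (X n) y) 0 < e"
        by (auto simp: eventually_sequentially)
    qed
    then show "(\<lambda>n. inner (X n - z) y) \<longlonglongrightarrow> 0"
      using y[of z] z(1) i by (auto simp: inner_diff_left)
  qed (fact subspace closed)+
  then show ?thesis by (simp add: inner_diff_left LIM_zero_iff)
qed

end

section \<open>From finite \<open>max_gap\<close> to occurrences in every window\<close>

text \<open>The first occurrence after \<open>m\<close> exceeds its predecessor, which is at most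
  \<open>m\<close>, by at most \<open>K\<close>. The convention that occurrence number
  \<open>0\<close> is \<open>0\<close> covers the initial stretch.\<close>

lemma occurrence_gap_bound:
  assumes inf: "infinite (occurrences \<sigma> j)" and "max_gap \<sigma> j < \<infinity>"
  obtains K where "\<And>m. \<exists>p. m < p \<and> p \<le> m + K \<and> \<sigma> p = j"
proof -
  obtain K where K: "max_gap \<sigma> j = enat K"
    using assms(2) by auto
  have gap: "occurrence \<sigma> j n - occurrence \<sigma> j (n - 1) \<le> K" if "n \<ge> 1" for n
  proof -
    have "enat (occurrence \<sigma> j n - occurrence \<sigma> j (n - 1)) \<le> max_gap \<sigma> j"
      unfolding max_gap_def using that by (intro SUP_upper) auto
    then show ?thesis using K by simp
  qed
  have "\<exists>p. m < p \<and> p \<le> m + K \<and> \<sigma> p = j" for m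
  proof -
    \<comment> \<open>Occurrence number \<open>Suc (Suc m)\<close> is \<open>enumerate\<close> at
      \<open>Suc m\<close>, which is at least \<open>Suc m\<close>.\<close>
    have "m < occurrence \<sigma> j (Suc (Suc m))"
      using le_enumerate[OF inf, of "Suc m"] by (simp add: occurrence_def)
    define n where "n = (LEAST n. m < occurrence \<sigma> j n)"
    have n: "m < occurrence \<sigma> j n"
      unfolding n_def by (rule LeastI) fact
    then have "n \<ge> 1" by (cases n) (auto simp: occurrence_def)
    then have "\<not> m < occurrence \<sigma> j (n - 1)"
      unfolding n_def by (intro not_less_Least) simp
    then have "occurrence \<sigma> j n \<le> m + K" using gap[OF \<open>n \<ge> 1\<close>] by simp
    moreover have "\<sigma> (occurrence \<sigma> j n) = j"
      using enumerate_in_set[OF inf, of "n - 1"] \<open>n \<ge> 1\<close> by (simp add: occurrence_def occurrences_def)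
    ultimately show ?thesis using n by blast
  qed
  then show ?thesis by (rule that)
qed

section \<open>Reduction of the complex structure to the real inner product\<close>

lemma csubspace_imp_subspace: "csubspace M \<Longrightarrow> subspace M"
  unfolding csubspace_def subspace_def by (simp add: scaleR_scaleC)

text \<open>Conjugate linearity in the second argument produces the factor \<open>cnj \<i>\<close>,
  which turns the imaginary part into a real part. Real weak convergence thus yields complex weak
  convergence.\<close>

lemma Im_cinner: "Im (cinner x y) = inner x (\<i> *\<^sub>C y)"
proof -
  have "cinner x (\<i> *\<^sub>C y) = cnj \<i> * cinner x y"
    using cinner_commute[of x "\<i> *\<^sub>C y"] cinner_commute[of x y] by (simp add: cinner_scaleC_left)
  then show ?thesis by (simp add: inner_eq_Re_cinner)
qed

lemma converges_weakly_if_inner_tendsto: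
  assumes "\<And>y. (\<lambda>n. inner (X n) y) \<longlonglongrightarrow> inner x y"
  shows "converges_weakly X x"
  unfolding converges_weakly_def
  using assms by (simp add: tendsto_complex_iff Im_cinner inner_eq_Re_cinner[symmetric])

lemma orthogonal_projection_onto_inner:
  assumes "orthogonal_projection_onto P M"
  shows "P x \<in> M" "u \<in> M \<Longrightarrow> inner (x - P x) u = 0"
  using assms by (auto simp: orthogonal_projection_onto_def inner_eq_Re_cinner)

text \<open>For \<open>u\<close> in \<open>M\<close> the residual \<open>u - P u\<close> lies in
  \<open>M\<close> and is orthogonal to \<open>M\<close>, so it vanishes.\<close>

lemma range_orthogonal_projection_onto:
  assumes "orthogonal_projection_onto P M" "csubspace M"
  shows "range P = M"
proof
  show "range P \<subseteq> M" using orthogonal_projection_onto_inner(1)[OF assms(1)] by auto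
  show "M \<subseteq> range P"
  proof
    fix u assume "u \<in> M"
    then have "u - P u \<in> M"
      using orthogonal_projection_onto_inner(1)[OF assms(1)] csubspace_imp_subspace[OF assms(2)]
      by (simp add: subspace_diff)
    then have "inner (u - P u) (u - P u) = 0"
      by (rule orthogonal_projection_onto_inner(2)[OF assms(1)])
    then have "u = P u" by simp
    then show "u \<in> range P" by (rule range_eqI)
  qed
qed

theorem theorem2p12:
  fixes M :: "nat \<Rightarrow> 'a::complex_hilbert_space set"
    and Pr T :: "nat \<Rightarrow> 'a \<Rightarrow> 'a"
    and P :: "'a \<Rightarrow> 'a"
    and \<sigma> :: "nat \<Rightarrow> nat"
    and r :: nat
  assumes "\<And>n. n \<ge> 1 \<Longrightarrow> csubspace (M n) \<and> closed (M n)"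
    and "\<And>n. n \<ge> 1 \<Longrightarrow> orthogonal_projection_onto (Pr n) (M n)"
    and "infinite_periodic \<sigma>"
    and "r \<ge> 1"
    and "Gamma_inf \<sigma> = {1..r}"
    and "T 1 = Pr (\<sigma> 1)"
    and "\<And>n. n \<ge> 2 \<Longrightarrow> T n = Pr (\<sigma> n) \<circ> T (n - 1)"
    and "orthogonal_projection_onto P (\<Inter>i\<in>{1..}. range (Pr i))"
  shows "\<forall>x. converges_weakly (\<lambda>n. T n x) (P x)"
proof
  fix x
  \<comment> \<open>The orbit starts at \<open>x\<close> itself, at time \<open>0\<close>; as the
    step from \<open>n\<close> to \<open>Suc n\<close> applies the projection number
    \<open>\<sigma> (Suc n)\<close>, the index sequence \<open>s\<close> is \<open>\<sigma>\<close>
    shifted by one.\<close>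
  define X where "X n = (if n = 0 then x else T n x)" for n
  define s where "s n = \<sigma> (Suc n)" for n
  have X_Suc: "X (Suc n) = Pr (s n) (X n)" for n
    using assms(6) assms(7)[of "Suc n"] by (cases n) (auto simp: X_def s_def)
  have "range s = \<sigma> ` {1..}"
    unfolding s_def by (auto simp: image_iff) (metis Suc_le_D)
  then have range_s: "range s = {1..}"
    using assms(3) by (simp add: infinite_periodic_def)
  have occ: "infinite (occurrences \<sigma> i)" if "i \<in> range s" for i
    using assms(3) that range_s by (simp add: infinite_periodic_def)
  have s_ge: "s n \<ge> 1" for n using range_s by auto
  interpret projection_orbit M s X
  proof
    show "X (Suc n) \<in> M (s n)" for n
      unfolding X_Suc using orthogonal_projection_onto_inner(1) assms(2) s_ge by blast
    show "inner (X n - X (Suc n)) u = 0" if "u \<in> M (s n)" for u n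
      unfolding X_Suc using orthogonal_projection_onto_inner(2) assms(2) s_ge that by blast
  qed (use assms(1) range_s csubspace_imp_subspace in auto)
  have "bounded_gaps i" if i: "i \<in> Gamma_fin \<sigma>" for i
  proof -
    have "infinite (occurrences \<sigma> i)" "max_gap \<sigma> i < \<infinity>"
      using i occ range_s by (auto simp: Gamma_fin_def)
    then obtain K where K: "\<And>m. \<exists>p. m < p \<and> p \<le> m + K \<and> \<sigma> p = i"
      by (rule occurrence_gap_bound) blast
    have "\<exists>p\<in>{m..m+K}. s p = i" for m
    proof -
      obtain p where "m < p" "p \<le> m + K" "\<sigma> p = i" using K by blast
      \<comment> \<open>The shift moves an occurrence in \<open>{m<..m+K}\<close> to a time in
        \<open>{m..<m+K}\<close>.\<close>
      then show ?thesis by (intro bexI[of _ "p - 1"]) (auto simp: s_def)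
    qed
    then show ?thesis unfolding bounded_gaps_def by blast
  qed
  then have "{i \<in> range s. \<not> bounded_gaps i} \<subseteq> Gamma_inf \<sigma>"
    unfolding range_s Gamma_inf_def by auto
  then have finite: "finite {i \<in> range s. \<not> bounded_gaps i}"
    by (rule finite_subset) (simp add: assms(5))
  have recurrent: "\<exists>p\<ge>m. s p = i" if i: "i \<in> range s" for i m
  proof -
    obtain p where "p > m" "p \<in> occurrences \<sigma> i"
      using occ[OF i] unfolding infinite_nat_iff_unbounded by blast
    then show ?thesis by (intro exI[of _ "p - 1"]) (auto simp: s_def occurrences_def)
  qed
  have "range (Pr i) = M i" if "i \<ge> 1" for i
    using range_orthogonal_projection_onto assms(1,2) that by blast
  then have Inter: "(\<Inter>i\<in>{1..}. range (Pr i)) = (\<Inter>i\<in>range s. M i)"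
    unfolding range_s by auto
  note P = orthogonal_projection_onto_inner[OF assms(8)[unfolded Inter]]
  have X0: "inner (X 0 - P x) u = 0" if "u \<in> (\<Inter>i\<in>range s. M i)" for u
    using P(2)[OF that] by (simp add: X_def)
  have "(\<lambda>n. inner (X n) y) \<longlonglongrightarrow> inner (P x) y" for y
    by (rule weakly_tendsto[OF finite recurrent P(1) X0])
  \<comment> \<open>\<open>X\<close> and \<open>T\<close> agree at positive times only, as
    \<open>T 0\<close> is arbitrary; the limit is transferred through the shifted sequence.\<close>
  then have "(\<lambda>n. inner (X (Suc n)) y) \<longlonglongrightarrow> inner (P x) y" for y
    by (rule LIMSEQ_Suc)
  then have "(\<lambda>n. inner (T n x) y) \<longlonglongrightarrow> inner (P x) y" for y
    by (subst filterlim_sequentially_Suc[symmetric]) (simp add: X_def)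
  then show "converges_weakly (\<lambda>n. T n x) (P x)"
    by (rule converges_weakly_if_inner_tendsto)
qed

end
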